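(* For every $p\ge1$, $P^{(-1/2)}_{p,0}=Q_p$ and $P^{(-1/2)}_{0,p}=Q_{-p}$, and for all $p,q\ge1$, $$P^{(-1/2)}_{p,q}=Q_pQ_{-q}-3^{-2\min(p,q)}Q_{p-q}.$$
   Context: $Z,\bar Z$ are treated as two independent variables (conjugate complex coordinates). The polynomials $T_p\in\mathbb{C}[Z,\bar Z]$, $p\in\mathbb{Z}$, are defined by $T_0=3$, $T_1=3Z$, $T_{-1}=3\bar Z$ and $T_{p+2}-3ZT_{p+1}+3\bar ZT_p-T_{p-1}=0$ for all $p\in\mathbb{Z}$ (equivalently, $T_p=z_1^p+z_2^p+z_3^p$ when $|z_i|=1$, $z_1z_2z_3=1$ and $Z=\frac13(z_1+z_2+z_3)$), and $Q_p=3^{-|p|}T_p$. For $\alpha>-5/6$ and $\lambda=\frac12(6\alpha+5)$ (so $\lambda=1$ when $\alpha=-\frac12$), the polynomials $P_{p,q}=P^{(\alpha)}_{p,q}(Z,\bar Z)$, $p,q\ge0$, are defined inductively by $P_{0,0}=1$, $P_{0,1}=\bar Z$, $P_{1,0}=Z$ and $$P_{p+1,q}=Z P_{p,q}+a_1(\lambda,p)P_{p-1,q+1}+a_2(\lambda,p,q)P_{p,q-1},\quad P_{p,q+1}=\bar Z P_{p,q}+a_1(\lambda,q)P_{p+1,q-1}+a_2(\lambda,q,p)P_{p-1,q},$$ where $$a_1(\lambda,p)=-\frac{p(3p+2\lambda-5)}{(\lambda+3p-1)(\lambda+3p-4)},\quad a_2(\lambda,p,q)=-\frac{q(3q+2\lambda-5)(\lambda+3(p+q)-1)(\lambda+p+q-2)}{(\lambda+3q-1)(2\lambda+3(p+q)-5)(2\lambda+3(p+q)-2)(\lambda+3q-4)},$$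 with $a_1(\lambda,0)=a_2(\lambda,p,0)=0$ and, when a denominator vanishes, the value being the limit as $\epsilon\to0$ of the same expression at $\lambda+\epsilon$. These polynomials are eigenvectors, with eigenvalue $-[(\lambda-1)(p+q)+p^2+q^2+pq]$, of $L^{(\alpha)}=(\bar Z-Z^2)\partial_Z^2+(1-Z\bar Z)\partial_Z\partial_{\bar Z}+(Z-\bar Z^2)\partial_{\bar Z}^2-\lambda(Z\partial_Z+\bar Z\partial_{\bar Z})$. *)

theory Defs
  imports "HOL-Computational_Algebra.Computational_Algebra" Complex_Main
begin

text \<open>
  The ring of polynomials over the complex numbers in the two independent variables \<open>Z\<close> and
  \<open>Zbar\<close> is rendered as \<^typ>\<open>complex poly poly\<close>: the inner variable is \<open>Z\<close>, the outer one is
  \<open>Zbar\<close>.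
\<close>

type_synonym bipoly = "complex poly poly"

definition Zvar :: bipoly where "Zvar = [:[:0, 1:]:]"

definition Zbar :: bipoly where "Zbar = [:0, 1:]"

definition scalar :: "real \<Rightarrow> bipoly" where "scalar c = [:[:complex_of_real c:]:]"

lemma scalar_simps [simp]:
  "scalar 0 = 0" "scalar 1 = 1"
  "scalar (a + b) = scalar a + scalar b"
  "scalar (a - b) = scalar a - scalar b"
  "scalar (- a) = - scalar a"
  "scalar (a * b) = scalar a * scalar b"
  by (simp_all add: scalar_def one_pCons)


subsection \<open>The polynomials \<open>T\<close> and \<open>Q\<close>\<close>

text \<open>
  The three-term relation determines \<open>T p\<close> from the initial values upwards for \<open>p \<ge> 2\<close> and
  downwards for \<open>p \<le> -2\<close>; lemma \<open>T_recurrence\<close> below confirms that it holds for all integers.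
\<close>

function T :: "int \<Rightarrow> bipoly" where
  "T p =
    (if p = 0 then 3
     else if p = 1 then 3 * Zvar
     else if p = - 1 then 3 * Zbar
     else if p > 1 then 3 * Zvar * T (p - 1) - 3 * Zbar * T (p - 2) + T (p - 3)
     else T (p + 3) - 3 * Zvar * T (p + 2) + 3 * Zbar * T (p + 1))"
  by auto
termination by (relation "measure (\<lambda>p. nat \<bar>p\<bar>)") auto

declare T.simps [simp del]

lemma T_initial: "T 0 = 3" "T 1 = 3 * Zvar" "T (- 1) = 3 * Zbar"
  by (simp_all add: T.simps)

lemma T_recurrence: "T (p + 2) - 3 * Zvar * T (p + 1) + 3 * Zbar * T p - T (p - 1) = 0"
proof (cases "p \<ge> 0")
  case True
  then show ?thesis
    by (subst T.simps[of "p + 2"]) (simp add: algebra_simps)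
next
  case False
  then show ?thesis
    by (subst T.simps[of "p - 1"]) (simp add: algebra_simps)
qed

definition Q :: "int \<Rightarrow> bipoly" where
  "Q p = scalar (3 powi (- \<bar>p\<bar>)) * T p"


subsection \<open>The coefficients of the recurrence\<close>

definition a1_expr :: "real \<Rightarrow> nat \<Rightarrow> real" where
  "a1_expr l p =
    - (real p * (3 * real p + 2 * l - 5) / ((l + 3 * real p - 1) * (l + 3 * real p - 4)))"

definition a1 :: "real \<Rightarrow> nat \<Rightarrow> real" where
  "a1 l p =
    (if p = 0 then 0
     else if (l + 3 * real p - 1) * (l + 3 * real p - 4) = 0
       then Lim (at 0) (\<lambda>\<epsilon>. a1_expr (l + \<epsilon>) p)
     else a1_expr l p)"

definition a2_denom :: "real \<Rightarrow> nat \<Rightarrow> nat \<Rightarrow> real" where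
  "a2_denom l p q =
    (l + 3 * real q - 1) * (2 * l + 3 * (real p + real q) - 5)
      * (2 * l + 3 * (real p + real q) - 2) * (l + 3 * real q - 4)"

definition a2_expr :: "real \<Rightarrow> nat \<Rightarrow> nat \<Rightarrow> real" where
  "a2_expr l p q =
    - (real q * (3 * real q + 2 * l - 5) * (l + 3 * (real p + real q) - 1)
         * (l + real p + real q - 2) / a2_denom l p q)"

definition a2 :: "real \<Rightarrow> nat \<Rightarrow> nat \<Rightarrow> real" where
  "a2 l p q =
    (if q = 0 then 0
     else if a2_denom l p q = 0 then Lim (at 0) (\<lambda>\<epsilon>. a2_expr (l + \<epsilon>) p q)
     else a2_expr l p q)"


subsection \<open>The polynomials \<open>P\<close>\<close>

definition lam :: "real \<Rightarrow> real" where "lam \<alpha> = (6 * \<alpha> + 5) / 2"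

text \<open>
  The two recurrences overdetermine the family.  The definition uses the one raising \<open>p\<close>
  throughout and the one raising \<open>q\<close> only for \<open>p = 0\<close>; lemmas \<open>P_raise_p\<close> and \<open>P_raise_q\<close> below
  show that both hold for all indices when \<open>\<alpha> > -5/6\<close>, and \<open>P_unique\<close> that they determine the
  family.  Terms with a negative index carry a vanishing coefficient and are dropped.
\<close>

function P :: "real \<Rightarrow> nat \<Rightarrow> nat \<Rightarrow> bipoly" where
  "P \<alpha> 0 0 = 1"
| "P \<alpha> (Suc p) q =
     Zvar * P \<alpha> p q
     + (if p = 0 then 0 else scalar (a1 (lam \<alpha>) p) * P \<alpha> (p - 1) (q + 1))
     + (if q = 0 then 0 else scalar (a2 (lam \<alpha>) p q) * P \<alpha> p (q - 1))"
| "P \<alpha> 0 (Suc q) =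
     Zbar * P \<alpha> 0 q
     + (if q = 0 then 0 else scalar (a1 (lam \<alpha>) q) * P \<alpha> 1 (q - 1))"
  by pat_completeness auto
termination by (relation "measures [\<lambda>(\<alpha>, p, q). p + q, \<lambda>(\<alpha>, p, q). p]") auto

declare P.simps [simp del]

lemma P_initial: "P \<alpha> 0 0 = 1" "P \<alpha> 0 1 = Zbar" "P \<alpha> 1 0 = Zvar"
  using P.simps(3)[of \<alpha> 0] P.simps(2)[of \<alpha> 0 0] by (simp_all add: P.simps(1))

lemma a_0 [simp]: "a1 l 0 = 0" "a2 l p 0 = 0"
  by (simp_all add: a1_def a2_def)

lemma P_raise_p:
  "P \<alpha> (p + 1) q =
     Zvar * P \<alpha> p q + scalar (a1 (lam \<alpha>) p) * P \<alpha> (p - 1) (q + 1)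
     + scalar (a2 (lam \<alpha>) p q) * P \<alpha> p (q - 1)"
  by (simp add: P.simps(2))

text \<open>Closed forms of the coefficients, including the limits occurring at \<open>l = 1\<close>.\<close>

lemma Lim_at_eq:
  fixes f g :: "real \<Rightarrow> real"
  assumes "isCont g 0" and "\<And>x. x \<noteq> 0 \<Longrightarrow> \<bar>x\<bar> < 1/2 \<Longrightarrow> f x = g x"
  shows "Lim (at 0) f = g 0"
proof (rule tendsto_Lim)
  have "eventually (\<lambda>x. g x = f x) (at 0)"
    unfolding eventually_at by (rule exI[of _ "1/2"]) (use assms(2) in \<open>auto simp: dist_real_def\<close>)
  moreover have "(g \<longlongrightarrow> g 0) (at 0)" using assms(1) by (simp add: isCont_def)
  ultimately show "(f \<longlongrightarrow> g 0) (at 0)" by (rule Lim_transform_eventually[rotated])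
qed simp

definition a1' :: "real \<Rightarrow> nat \<Rightarrow> real" where
  "a1' l p = (if p = 0 then 0 else if p = 1 then - 2 / (l + 2) else a1_expr l p)"

definition c' :: "real \<Rightarrow> nat \<Rightarrow> real" where
  "c' l s = (if s \<le> 1 then (l + 2) / (2 * (2 * l + 1))
     else (l + 3 * real s - 1) * (l + real s - 2) /
          ((2 * l + 3 * real s - 5) * (2 * l + 3 * real s - 2)))"

lemma a1_expr_1: 
  assumes "l > 0" "l \<noteq> 1" shows "a1_expr l 1 = - 2 / (l + 2)"
  using assms by (simp add: a1_expr_def divide_simps) (simp add: algebra_simps)

lemma a1_eq:
  assumes l: "l > 0" shows "a1 l p = a1' l p"
proof -
  consider "p = 0" | "p = 1" "l = 1" | "p = 1" "l \<noteq> 1" | "p \<ge> 2" by linarith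
  then show ?thesis
  proof cases
    case 2
    have "Lim (at 0) (\<lambda>\<epsilon>. a1_expr (1 + \<epsilon>) 1) = (\<lambda>x. - 2 / ((1 + x) + 2)) 0"
      by (rule Lim_at_eq) (use a1_expr_1 in \<open>auto intro!: continuous_intros\<close>)
    with 2 show ?thesis by (simp add: a1_def a1'_def)
  next
    case 3
    with l a1_expr_1[of l] show ?thesis by (simp add: a1_def a1'_def)
  next
    case 4
    then have "real p \<ge> 2" by simp
    with l have "l + 3 * real p - 1 > 0" "l + 3 * real p - 4 > 0" by linarith+
    with 4 show ?thesis by (simp add: a1_def a1'_def)
  qed (simp add: a1_def a1'_def)
qed

lemma a2_expr_factor:
  "a2_expr l p q = a1_expr l q * ((l + 3 * real (p + q) - 1) * (l + real (p + q) - 2) /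
     ((2 * l + 3 * real (p + q) - 5) * (2 * l + 3 * real (p + q) - 2)))"
proof -
  have "- (r * x * y * z / (a * b * c * d)) = - (r * x / (a * d)) * (y * z / (b * c))"
    for r x y z a b c d :: real by (simp add: mult_ac)
  then show ?thesis
    unfolding a2_expr_def a2_denom_def a1_expr_def of_nat_add add.assoc[of l "real p" "real q"] .
qed

lemma a2_expr_eq:
  assumes l: "l > 0" "l \<noteq> 1" and q: "q > 0" shows "a2_expr l p q = a1' l q * c' l (p + q)"
proof -
  have 1: "a1' l q = a1_expr l q" using a1_expr_1[OF l] q by (auto simp: a1'_def)
  have 2: "c' l (p + q) = (l + 3 * real (p + q) - 1) * (l + real (p + q) - 2) /
          ((2 * l + 3 * real (p + q) - 5) * (2 * l + 3 * real (p + q) - 2))"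
  proof (cases "p + q = 1")
    case True
    with l show ?thesis unfolding c'_def by (simp add: divide_simps) (simp add: algebra_simps)
  qed (use q in \<open>auto simp: c'_def\<close>)
  show ?thesis unfolding 1 2 by (rule a2_expr_factor)
qed

lemma a2_eq:
  assumes l: "l > 0" and q: "q > 0" shows "a2 l p q = a1' l q * c' l (p + q)"
proof (cases "l = 1")
  case False
  have "a2_denom l p q \<noteq> 0"
  proof -
    have "real q \<ge> 1" using q by simp
    moreover have "p + q = 1 \<or> p + q \<ge> 2" using q by linarith
    then have "real p + real q = 1 \<or> real p + real q \<ge> 2" by (auto simp flip: of_nat_add)
    moreover have "q = 1 \<or> real q \<ge> 2" using q by linarith
    ultimately show ?thesis using l False unfolding a2_denom_def by auto
  qed
  with a2_expr_eq[OF l False q] q show ?thesis by (simp add: a2_def)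
next
  case True
  have q1: "real q \<ge> 1" using q by simp
  show ?thesis
  proof (cases "q = 1")
    case False
    then have "real q \<ge> 2" using q by linarith
    then have "a2_denom l p q \<noteq> 0" using True unfolding a2_denom_def by auto
    with False q have "a2 l p q = a2_expr l p q" by (simp add: a2_def)
    also have "\<dots> = a1' l q * c' l (p + q)"
      using False q unfolding a2_expr_factor by (simp add: a1'_def c'_def)
    finally show ?thesis .
  next
    case q1: True
    have "a2_denom l p q = 0" using True q1 by (simp add: a2_denom_def)
    then have "a2 l p q = Lim (at 0) (\<lambda>\<epsilon>. a2_expr (1 + \<epsilon>) p q)" 
      using q1 True by (simp add: a2_def)
    also have "\<dots> = (\<lambda>x. a1' (1 + x) q * c' (1 + x) (p + q)) 0"
    proof (rule Lim_at_eq)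
      show "isCont (\<lambda>x. a1' (1 + x) q * c' (1 + x) (p + q)) 0"
        unfolding a1'_def c'_def q1 by (cases "p = 0") (auto intro!: continuous_intros)
    qed (use q in \<open>auto intro!: a2_expr_eq\<close>)
    finally show ?thesis by (simp add: True)
  qed
qed

lemma a2_eq':
  assumes l: "l > 0" shows "a2 l p q = a1' l q * c' l (p + q)"
  using a2_eq[OF l] by (cases "q = 0") (auto simp: a1'_def)

lemma recip_identity:
  fixes u v :: real
  defines "h \<equiv> (\<lambda>x :: real. 1 / (x * (x - 3)))"
  assumes nz: "u \<noteq> 0" "v \<noteq> 0" "u - 3 \<noteq> 0" "v - 3 \<noteq> 0" "u + 3 \<noteq> 0" "v + 3 \<noteq> 0"
    "u + v \<noteq> 0" "u + v - 3 \<noteq> 0" "u + v + 3 \<noteq> 0"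
  shows "h v * h (u + 3) - h u * h (v + 3)
    = h (u + v) * (h v - h u) + h (u + v + 3) * (h (u + 3) - h (v + 3))"
proof -
  have s: "u + 3 - 3 = u" "v + 3 - 3 = v" "u + v + 3 - 3 = u + v" by auto
  show ?thesis unfolding h_def s using nz
    apply (simp add: divide_simps del: diff_eq_eq eq_diff_eq right_minus_eq)
    apply algebra
    done
qed

lemma coeff_identity:
  assumes l: "l > 0"
  shows "a1' l q * a1' l (Suc p) - a1' l p * a1' l (Suc q)
     + c' l (p + q) * (a1' l q - a1' l p)
     + c' l (Suc (p + q)) * (a1' l (Suc p) - a1' l (Suc q)) = 0"
proof -
  define K where "K = (l - 1) * (l - 4)"
  define h where "h = (\<lambda>x :: real. 1 / (x * (x - 3)))"
  have l_pos: "l + 3 * real x - 1 > 0" "l + 3 * real x - 4 > 0" if "x \<ge> 2" for x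
  proof -
    have "real x \<ge> 2" using that by simp
    with l show "l + 3 * real x - 1 > 0" "l + 3 * real x - 4 > 0" by linarith+
  qed
  have l_pos': "2 * l + 3 * real x - 5 > 0" "2 * l + 3 * real x - 2 > 0" if "x \<ge> 2" for x
  proof -
    have "real x \<ge> 2" using that by simp
    with l show "2 * l + 3 * real x - 5 > 0" "2 * l + 3 * real x - 2 > 0" by linarith+
  qed
  have frac_a: "- (x * (3 * x + 2 * l - 5) / ((l + 3 * x - 1) * (l + 3 * x - 4)))
      = - 1 / 3 * (1 - K * h (l + 3 * x - 1))"
    if "l + 3 * x - 1 \<noteq> 0" "l + 3 * x - 4 \<noteq> 0" for x
  proof -
    have "l + 3 * x - 1 - 3 = l + 3 * x - 4" by simp
    with that show ?thesis unfolding K_def h_def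
      by (simp add: divide_simps del: diff_eq_eq eq_diff_eq right_minus_eq) algebra
  qed
  have frac_c: "(l + 3 * x - 1) * (l + x - 2) / ((2 * l + 3 * x - 5) * (2 * l + 3 * x - 2))
      = 1 / 3 * (1 - K * h (2 * l + 3 * x - 2))"
    if "2 * l + 3 * x - 5 \<noteq> 0" "2 * l + 3 * x - 2 \<noteq> 0" for x
  proof -
    have "2 * l + 3 * x - 2 - 3 = 2 * l + 3 * x - 5" by simp
    with that show ?thesis unfolding K_def h_def
      by (simp add: divide_simps del: diff_eq_eq eq_diff_eq right_minus_eq) algebra
  qed
  have a_big: "a1' l x = - 1 / 3 * (1 - K * h (l + 3 * real x - 1))" if "x \<ge> 2" for x
    using that frac_a[of "real x"] l_pos[of x] by (simp add: a1'_def a1_expr_def)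
  have c_big: "c' l x = 1 / 3 * (1 - K * h (2 * l + 3 * real x - 2))" if "x \<ge> 2" for x
    using that frac_c[of "real x"] l_pos'[of x] by (simp add: c'_def)
  consider "l = 1" | "l = 4" | "l \<noteq> 1" "l \<noteq> 4" by blast
  then show ?thesis
  proof cases
    case 1
    then have "a1' l x = (if x = 0 then 0 else if x = 1 then - 2 / 3 else - 1 / 3)"
      "c' l x = (if x \<le> 1 then 1 / 2 else 1 / 3)" for x
      using a_big[of x] c_big[of x] by (auto simp: K_def a1'_def c'_def)
    then show ?thesis by auto
  next
    case 2
    then have ac: "a1' l x = (if x = 0 then 0 else - 1 / 3)" "c' l x = 1 / 3" for x
      using a_big[of x] c_big[of x]
      by (cases "x = 0"; cases "x = 1"; auto simp: K_def a1'_def c'_def)+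
    show ?thesis unfolding ac by auto
  next
    case 3
    have nz: "l + 3 * real x - 1 \<noteq> 0" "l + 3 * real x - 4 \<noteq> 0" for x
    proof -
      consider "x = 0" | "x = 1" | "x \<ge> 2" by linarith
      then have "l + 3 * real x - 1 \<noteq> 0 \<and> l + 3 * real x - 4 \<noteq> 0"
        by cases (use 3 l l_pos[of x] in auto)
      then show "l + 3 * real x - 1 \<noteq> 0" "l + 3 * real x - 4 \<noteq> 0" by blast+
    qed
    have a: "a1' l x = - 1 / 3 * (1 - K * h (l + 3 * real x - 1))" for x
    proof -
      have "a1' l x = a1_expr l x" using a1_expr_1[OF l] 3 by (auto simp: a1'_def a1_expr_def)
      then show ?thesis using frac_a[OF nz[of x]] by (simp add: a1_expr_def)
    qed
    have c: "c' l x = 1 / 3 * (1 - K * h (2 * l + 3 * real x - 2))" if "x \<ge> 1" for x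
    proof (cases "x = 1")
      case True
      with l 3 show ?thesis unfolding K_def h_def c'_def
        by (simp add: divide_simps) (simp add: algebra_simps)
    qed (use that c_big in auto)
    show ?thesis
    proof (cases "p + q = 0")
      case False
      then have "p + q \<ge> 1" by linarith
      note c1 = c[OF this]
      have c2: "c' l (Suc (p + q)) = 1 / 3 * (1 - K * h (2 * l + 3 * real (Suc (p + q)) - 2))"
        by (rule c) simp
      define u where "u = l + 3 * real p - 1"
      define v where "v = l + 3 * real q - 1"
      have w: "u + v \<noteq> 0" "u + v - 3 \<noteq> 0" "u + v + 3 \<noteq> 0"
      proof -
        have "p + q = 1 \<or> p + q \<ge> 2" using False by linarith
        then have "real p + real q = 1 \<or> real p + real q \<ge> 2" by (auto simp flip: of_nat_add)
        then show "u + v \<noteq> 0" "u + v - 3 \<noteq> 0" "u + v + 3 \<noteq> 0"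
          using l 3 by (auto simp: u_def v_def)
      qed
      have "u \<noteq> 0" "v \<noteq> 0" "u - 3 \<noteq> 0" "v - 3 \<noteq> 0" "u + 3 \<noteq> 0" "v + 3 \<noteq> 0"
        using nz[of p] nz[of q] nz[of "Suc p"] nz[of "Suc q"] by (auto simp: u_def v_def)
      from recip_identity[OF this w]
      have H: "h v * h (u + 3) - h u * h (v + 3)
          = h (u + v) * (h v - h u) + h (u + v + 3) * (h (u + 3) - h (v + 3))"
        by (simp only: h_def)
      have e: "a1' l p = - 1 / 3 * (1 - K * h u)" "a1' l q = - 1 / 3 * (1 - K * h v)"
        "a1' l (Suc p) = - 1 / 3 * (1 - K * h (u + 3))"
        "a1' l (Suc q) = - 1 / 3 * (1 - K * h (v + 3))"
        "c' l (p + q) = 1 / 3 * (1 - K * h (u + v))"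
        "c' l (Suc (p + q)) = 1 / 3 * (1 - K * h (u + v + 3))"
        using a[of p] a[of q] a[of "Suc p"] a[of "Suc q"] c1 c2
        by (simp_all add: u_def v_def algebra_simps)
      show ?thesis unfolding e using H by algebra
    qed auto
  qed
qed

lemma raise_q_from_raise_p:
  fixes a :: "nat \<Rightarrow> 'r :: comm_ring_1"
  assumes a0: "a 0 = 0" and b0: "\<And>p. b p 0 = 0"
    and i1: "\<And>p q. a q * a (Suc p) - a p * a (Suc q) - b q p + b p q + b q (Suc p) - b p (Suc q) = 0"
    and i2: "\<And>p q. a q * b (Suc p) (q - 1) = b p q * a (q - 1)"
    and i4: "\<And>p q. b q p * b (p - 1) q = b p q * b (q - 1) p"
    and r1: "\<And>p q. e (Suc p) q = Z * e p q + a p * e (p - 1) (Suc q) + b p q * e p (q - 1)"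
    and r2: "\<And>q. e 0 (Suc q) = W * e 0 q + a q * e 1 (q - 1)"
  shows "e p (Suc q) = W * e p q + a q * e (Suc p) (q - 1) + b q p * e (p - 1) q"
proof (induction "p + q" arbitrary: p q rule: less_induct)
  case less
  show ?case
  proof (cases p)
    case 0
    then show ?thesis using r2[of q] b0 by simp
  next
    case (Suc m)
    have w1: "W * e m q = e m (Suc q) - a q * e (Suc m) (q - 1) - b q m * e (m - 1) q"
      using less[of m q] Suc by (simp add: algebra_simps)
    have w2: "a m * (W * e (m - 1) (Suc q)) = a m * (e (m - 1) (Suc (Suc q))
        - a (Suc q) * e m q - b (Suc q) (m - 1) * e (m - 1 - 1) (Suc q))"
      using less[of "m - 1" "Suc q"] Suc a0 by (cases m) (auto simp: algebra_simps)
    have w3: "b m q * (W * e m (q - 1)) = b m q * (e m q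
        - a (q - 1) * e (Suc m) (q - 1 - 1) - b (q - 1) m * e (m - 1) (q - 1))"
      using less[of m "q - 1"] Suc b0 by (cases q) (auto simp: algebra_simps)
    have z1: "Z * e m (Suc q) = e (Suc m) (Suc q) - a m * e (m - 1) (Suc (Suc q)) - b m (Suc q) * e m q"
      using r1[of m "Suc q"] by (simp add: algebra_simps)
    have z2: "a q * (Z * e (Suc m) (q - 1)) = a q * (e (Suc (Suc m)) (q - 1)
        - a (Suc m) * e m q - b (Suc m) (q - 1) * e (Suc m) (q - 1 - 1))"
      using r1[of "Suc m" "q - 1"] a0 by (cases q) (auto simp: algebra_simps)
    have z3: "b q m * (Z * e (m - 1) q) = b q m * (e m q
        - a (m - 1) * e (m - 1 - 1) (Suc q) - b (m - 1) q * e (m - 1) (q - 1))"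
      using r1[of "m - 1" q] b0 by (cases m) (auto simp: algebra_simps)
    have "W * e (Suc m) q = Z * (W * e m q) + a m * (W * e (m - 1) (Suc q)) + b m q * (W * e m (q - 1))"
      by (simp add: r1[of m q] algebra_simps)
    also have "Z * (W * e m q) = Z * e m (Suc q) - a q * (Z * e (Suc m) (q - 1)) - b q m * (Z * e (m - 1) q)"
      by (simp add: w1 algebra_simps)
    finally have W: "W * e (Suc m) q = Z * e m (Suc q) - a q * (Z * e (Suc m) (q - 1))
       - b q m * (Z * e (m - 1) q) + a m * (W * e (m - 1) (Suc q)) + b m q * (W * e m (q - 1))" .
    have "W * e (Suc m) q + a q * e (Suc (Suc m)) (q - 1) + b q (Suc m) * e m q - e (Suc m) (Suc q)
       = (a q * a (Suc m) - a m * a (Suc q) - b q m + b m q + b q (Suc m) - b m (Suc q)) * e m q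
       + (a q * b (Suc m) (q - 1) - b m q * a (q - 1)) * e (Suc m) (q - 1 - 1)
       - (a m * b (Suc q) (m - 1) - b q m * a (m - 1)) * e (m - 1 - 1) (Suc q)
       + (b q m * b (m - 1) q - b m q * b (q - 1) m) * e (m - 1) (q - 1)"
      unfolding W z1 z2 z3 w2 w3 by (simp only: algebra_simps)
    also have "\<dots> = 0" by (simp only: i1 i2 i4) simp
    finally show ?thesis using Suc by (simp add: algebra_simps)
  qed
qed

lemma P_raise_q:
  assumes "\<alpha> > - 5 / 6"
  shows "P \<alpha> p (q + 1) =
     Zbar * P \<alpha> p q + scalar (a1 (lam \<alpha>) q) * P \<alpha> (p + 1) (q - 1)
     + scalar (a2 (lam \<alpha>) q p) * P \<alpha> (p - 1) q"
proof -
  define l where "l = lam \<alpha>"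
  have l: "l > 0" using assms by (simp add: l_def lam_def)
  note eqs = a1_eq[OF l] a2_eq'[OF l]
  have "P \<alpha> p (Suc q) =
     Zbar * P \<alpha> p q + scalar (a1 l q) * P \<alpha> (Suc p) (q - 1) + scalar (a2 l q p) * P \<alpha> (p - 1) q"
  proof (rule raise_q_from_raise_p[where a = "\<lambda>p. scalar (a1 l p)" and b = "\<lambda>p q. scalar (a2 l p q)" and Z = Zvar])
    fix p q
    have "a1 l q * a1 l (Suc p) - a1 l p * a1 l (Suc q) - a2 l q p + a2 l p q + a2 l q (Suc p) - a2 l p (Suc q) = 0"
      using coeff_identity[OF l, of q p] by (simp add: eqs algebra_simps)
    from arg_cong[OF this, of scalar]
    show "scalar (a1 l q) * scalar (a1 l (Suc p)) - scalar (a1 l p) * scalar (a1 l (Suc q))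
       - scalar (a2 l q p) + scalar (a2 l p q) + scalar (a2 l q (Suc p)) - scalar (a2 l p (Suc q)) = 0"
      by simp
    have "a1 l q * a2 l (Suc p) (q - 1) = a2 l p q * a1 l (q - 1)"
      by (cases q) (auto simp: eqs)
    then show "scalar (a1 l q) * scalar (a2 l (Suc p) (q - 1)) = scalar (a2 l p q) * scalar (a1 l (q - 1))"
      by (metis scalar_simps(6))
    have "a2 l q p * a2 l (p - 1) q = a2 l p q * a2 l (q - 1) p"
      by (cases p; cases q) (auto simp: eqs a1'_def add.commute)
    then show "scalar (a2 l q p) * scalar (a2 l (p - 1) q) = scalar (a2 l p q) * scalar (a2 l (q - 1) p)"
      by (metis scalar_simps(6))
    show "P \<alpha> (Suc p) q = Zvar * P \<alpha> p q + scalar (a1 l p) * P \<alpha> (p - 1) (Suc q) + scalar (a2 l p q) * P \<alpha> p (q - 1)"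
      using P_raise_p[of \<alpha> p q] by (simp add: l_def)
    show "P \<alpha> 0 (Suc q) = Zbar * P \<alpha> 0 q + scalar (a1 l q) * P \<alpha> 1 (q - 1)"
      by (simp add: l_def P.simps(3))
  qed simp_all
  then show ?thesis by (simp add: l_def)
qed

lemma P_unique:
  fixes R :: "nat \<Rightarrow> nat \<Rightarrow> bipoly"
  assumes "R 0 0 = 1"
    and rp: "\<And>p q. R (p + 1) q = Zvar * R p q + scalar (a1 (lam \<alpha>) p) * R (p - 1) (q + 1)
            + scalar (a2 (lam \<alpha>) p q) * R p (q - 1)"
    and rq: "\<And>p q. R p (q + 1) = Zbar * R p q + scalar (a1 (lam \<alpha>) q) * R (p + 1) (q - 1)
            + scalar (a2 (lam \<alpha>) q p) * R (p - 1) q"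
  shows "R p q = P \<alpha> p q"
proof (induction \<alpha>' \<equiv> \<alpha> p q rule: P.induct)
  case 1
  then show ?case by (simp add: assms(1) P.simps(1))
next
  case (2 p q)
  then show ?case using rp[of p q] by (cases "p = 0"; cases "q = 0") (simp_all add: P.simps(2))
next
  case (3 q)
  then show ?case using rq[of 0 q] by (cases "q = 0") (simp_all add: P.simps(3))
qed

end

(* With T p = z1^p + z2^p + z3^p, the sum T m * T n - T (m + n) runs over z_i^m * z_j^n with i and j
   distinct. Multiplying it by T 1 and using z1 z2 z3 = 1 for the third index gives a three-term
   product formula. The P p q at alpha = -1/2 (lambda = 1) are, up to the factor 3^-(p+q), the sums
   of the distinct monomials among these with m = p, n = -q: a monomial is repeated 2 times if one
   exponent is 0 and 6 times if both are, which accounts for the exceptional values of a1 and a2. *)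
theory Submission
  imports Defs
begin

section \<open>Sums over pairs of distinct indices and their product formula\<close>

definition pair_sum :: "int \<Rightarrow> int \<Rightarrow> bipoly" where
  "pair_sum m n = T m * T n - T (m + n)"

lemma pair_sum_commute: "pair_sum m n = pair_sum n m"
  by (simp add: pair_sum_def algebra_simps)

lemma pair_sum_0: "pair_sum m 0 = 2 * T m" "pair_sum 0 m = 2 * T m"
  by (simp_all add: pair_sum_def T_initial)

text \<open>As functions of \<open>n\<close>, both \<open>T n\<close> and its shift
  \<open>T (m + n)\<close> solve the recurrence, and the factor \<open>T m\<close> is
  constant.\<close>

lemma pair_sum_recurrence:
  "pair_sum m (n + 2) - 3 * Zvar * pair_sum m (n + 1) + 3 * Zbar * pair_sum m n
    - pair_sum m (n - 1) = 0"
proof -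
  have "T (m + (n + 2)) = 3 * Zvar * T (m + (n + 1)) - 3 * Zbar * T (m + n) + T (m + (n - 1))"
    using T_recurrence[of "m + n"] by (simp add: algebra_simps)
  moreover have "T (n + 2) = 3 * Zvar * T (n + 1) - 3 * Zbar * T n + T (n - 1)"
    using T_recurrence[of n] by (simp add: algebra_simps)
  ultimately show ?thesis
    unfolding pair_sum_def by (simp only:) (simp add: algebra_simps)
qed

text \<open>The outer coefficients are 1 and -1, so three consecutive zeros propagate both upwards
  and downwards.\<close>

lemma three_term_recurrence_zero:
  fixes f :: "int \<Rightarrow> 'a :: comm_ring_1"
  assumes rec: "\<And>n. f (n + 2) - a * f (n + 1) + b * f n - f (n - 1) = 0"
    and init: "f (- 1) = 0" "f 0 = 0" "f 1 = 0"
  shows "f n = 0"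
proof -
  have up: "f (int k - 1) = 0 \<and> f (int k) = 0 \<and> f (int k + 1) = 0" for k
  proof (induction k)
    case (Suc k)
    then show ?case using rec[of "int k"] by (simp add: add_ac)
  qed (use init in simp)
  have down: "f (- 1 - int k) = 0 \<and> f (- int k) = 0 \<and> f (1 - int k) = 0" for k
  proof (induction k)
    case (Suc k)
    then show ?case using rec[of "- 1 - int k"] by (simp add: algebra_simps)
  qed (use init in simp)
  show ?thesis using up[of "nat n"] down[of "nat (- n)"] by (cases "n \<ge> 0") auto
qed

definition pair_defect :: "int \<Rightarrow> int \<Rightarrow> bipoly" where
  "pair_defect m n = 3 * Zvar * pair_sum m n
     - pair_sum (m + 1) n - pair_sum m (n + 1) - pair_sum (m - 1) (n - 1)"

lemma pair_defect_commute: "pair_defect m n = pair_defect n m"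
  unfolding pair_defect_def
  by (simp add: pair_sum_commute[of m] pair_sum_commute[of "m + 1"] pair_sum_commute[of "m - 1"])

text \<open>Each summand of the defect is, in \<open>n\<close>, a shifted \<open>pair_sum\<close>
  with a coefficient free of \<open>n\<close>, so the linear recurrence is inherited.\<close>

lemma pair_defect_recurrence:
  "pair_defect m (n + 2) - 3 * Zvar * pair_defect m (n + 1) + 3 * Zbar * pair_defect m n
    - pair_defect m (n - 1) = 0"
proof -
  define r where "r k j = pair_sum k (j + 2) - 3 * Zvar * pair_sum k (j + 1)
      + 3 * Zbar * pair_sum k j - pair_sum k (j - 1)" for k j
  have r0: "r k j = 0" for k j
    unfolding r_def by (rule pair_sum_recurrence)
  have "pair_defect m (n + 2) - 3 * Zvar * pair_defect m (n + 1) + 3 * Zbar * pair_defect m n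
      - pair_defect m (n - 1)
      = 3 * Zvar * r m n - r (m + 1) n - r m (n + 1) - r (m - 1) (n - 1)"
    unfolding pair_defect_def r_def by (simp add: algebra_simps)
  then show ?thesis by (simp add: r0)
qed

text \<open>The base values of \<open>pair_defect\<close> reach from \<open>T 3\<close>, in
  \<open>pair_sum 2 1\<close>, down to \<open>T (- 4)\<close>, in
  \<open>pair_sum (- 2) (- 2)\<close>.\<close>

lemma T_2: "T 2 = 9 * Zvar^2 - 6 * Zbar" "T (- 2) = 9 * Zbar^2 - 6 * Zvar"
  using T_recurrence[of 0] T_recurrence[of "- 1"]
  by (simp_all add: T_initial algebra_simps power2_eq_square)

lemma T_3: "T 3 = 27 * Zvar^3 - 27 * Zvar * Zbar + 3"
  using T_recurrence[of 1]
  by (simp add: T_initial T_2 algebra_simps power2_eq_square power3_eq_cube)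

lemma T_m3: "T (- 3) = 27 * Zbar^3 - 27 * Zvar * Zbar + 3"
  using T_recurrence[of "- 2"]
  by (simp add: T_initial T_2 algebra_simps power2_eq_square power3_eq_cube)

lemma T_m4: "T (- 4) = T (- 1) - 3 * Zvar * T (- 2) + 3 * Zbar * T (- 3)"
  using T_recurrence[of "- 3"] by (simp add: algebra_simps)

text \<open>The recurrence in each argument reduces the claim to the nine points with both arguments
  in {-1, 0, 1}; symmetry leaves six to compute.\<close>

lemma pair_defect_zero: "pair_defect m n = 0"
proof -
  have base: "pair_defect (- 1) (- 1) = 0" "pair_defect (- 1) 0 = 0" "pair_defect (- 1) 1 = 0"
    "pair_defect 0 0 = 0" "pair_defect 0 1 = 0" "pair_defect 1 1 = 0"
    unfolding pair_defect_def pair_sum_def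
    by (simp_all add: T_initial T_2 T_3 T_m3 T_m4 algebra_simps power2_eq_square power3_eq_cube)
  note base = base base(2,3,5)[unfolded pair_defect_commute[of "- 1"] pair_defect_commute[of 0 1]]
  note rec = pair_defect_recurrence
  have "pair_defect (- 1) n = 0" "pair_defect 0 n = 0" "pair_defect 1 n = 0" for n
    by (rule three_term_recurrence_zero[OF rec]; simp only: base)+
  then have "pair_defect n (- 1) = 0" "pair_defect n 0 = 0" "pair_defect n 1 = 0" for n
    unfolding pair_defect_commute[of n] by blast+
  then show ?thesis by (rule three_term_recurrence_zero[OF rec])
qed

lemma pair_sum_raise:
  "pair_sum (m + 1) n = 3 * Zvar * pair_sum m n - pair_sum m (n + 1) - pair_sum (m - 1) (n - 1)"
  using pair_defect_zero[of m n] by (simp add: pair_defect_def algebra_simps)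

section \<open>Orbit sums and the recurrence coefficients at lambda = 1\<close>

text \<open>The exceptional cases are \<open>pair_sum\<close> divided by its multiplicity: 2 on the
  axes, 6 at the origin.\<close>

definition orbit_sum :: "nat \<Rightarrow> nat \<Rightarrow> bipoly" where
  "orbit_sum p q =
    (if p = 0 \<and> q = 0 then 1 else if p = 0 then T (- int q) else if q = 0 then T (int p)
     else pair_sum (int p) (- int q))"

lemma scalar_of_nat: "scalar (of_nat n) = of_nat n"
  by (simp add: scalar_def of_nat_poly)

lemma scalar_numeral: "scalar (numeral n) = numeral n"
  using scalar_of_nat[of "numeral n"] by simp

lemma scalar_power: "scalar (c ^ n) = scalar c ^ n"
  by (induction n) simp_all

lemma a1_lam_1:
  "scalar (a1 1 p) * 3 = (if p = 0 then 0 else if p = 1 then - 2 else - 1)"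
proof -
  have "real p > 1" if "p \<noteq> 0" "p \<noteq> 1" using that by simp
  then have "a1 1 p * 3 = (if p = 0 then 0 else if p = 1 then - 2 else - 1)"
    by (auto simp: a1_eq a1'_def a1_expr_def divide_simps)
  from arg_cong[OF this, of scalar] show ?thesis
    by (auto simp: scalar_numeral split: if_splits)
qed

lemma a2_lam_1:
  "scalar (a2 1 p q) * 9 =
    (if q = 0 then 0 else if q = 1 then if p = 0 then - 3 else - 2 else - 1)"
proof -
  have "a1' 1 q = (if q = 0 then 0 else if q = 1 then - 2 / 3 else - 1 / 3)"
  proof -
    have "real q > 1" if "q \<noteq> 0" "q \<noteq> 1" using that by simp
    then show ?thesis by (auto simp: a1'_def a1_expr_def divide_simps)
  qed
  moreover have "c' 1 (p + q) = (if p + q \<le> 1 then 1 / 2 else 1 / 3)"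
  proof -
    have "real p + real q > 1" if "\<not> p + q \<le> 1" using that by linarith
    then show ?thesis by (auto simp: c'_def divide_simps)
  qed
  ultimately have
    "a2 1 p q * 9 = (if q = 0 then 0 else if q = 1 then if p = 0 then - 3 else - 2 else - 1)"
    by (auto simp: a2_eq')
  from arg_cong[OF this, of scalar] show ?thesis
    by (auto simp: scalar_numeral split: if_splits)
qed

text \<open>For positive \<open>p\<close> and \<open>q\<close> this is
  \<open>pair_sum_raise\<close>. For \<open>p = 0\<close> it is the definition of
  \<open>pair_sum\<close> with \<open>T 1 = 3 * Zvar\<close>, and for \<open>q = 0\<close> the
  recurrence of \<open>T\<close>.\<close>

lemma orbit_sum_raise_p:
  "orbit_sum (Suc p) q = 3 * Zvar * orbit_sum p q
     + scalar (a1 1 p) * 3 * orbit_sum (p - 1) (q + 1)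
     + scalar (a2 1 p q) * 9 * orbit_sum p (q - 1)"
proof -
  consider "p = 0" "q = 0" | "p = 0" "q = 1" | "p = 0" "q \<ge> 2" | "p = 1" "q = 0"
    | "p \<ge> 2" "q = 0" | "p \<ge> 1" "q \<ge> 1" by linarith
  then show ?thesis
  proof cases
    case 5
    then show ?thesis unfolding a1_lam_1 a2_lam_1 orbit_sum_def pair_sum_def
      \<comment> \<open>Since \<open>T (- 1) = 3 * Zbar\<close>, the term
        \<open>pair_sum (int p - 1) (- 1)\<close> supplies the two lower terms of the
        recurrence.\<close>
      using T_recurrence[of "int p - 1"]
      by (simp add: T_initial of_nat_diff algebra_simps)
  next
    case 6
    have e: "- int q - 1 = - 1 - int q" by simp
    \<comment> \<open>At \<open>p = 1\<close> the coefficient -2 makes up for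
      \<open>orbit_sum 0 (q + 1)\<close> being half of a \<open>pair_sum\<close>; likewise at
      \<open>q = 1\<close> in \<open>b\<close>.\<close>
    have a: "scalar (a1 1 p) * 3 * orbit_sum (p - 1) (q + 1)
        = - pair_sum (int p - 1) (- 1 - int q)"
      using 6 unfolding a1_lam_1 orbit_sum_def
      by (auto simp: pair_sum_0 of_nat_diff algebra_simps)
    have b: "scalar (a2 1 p q) * 9 * orbit_sum p (q - 1) = - pair_sum (int p) (- int q + 1)"
      using 6 unfolding a2_lam_1 orbit_sum_def
      by (auto simp: pair_sum_0 of_nat_diff algebra_simps)
    show ?thesis unfolding a b using 6 pair_sum_raise[of "int p" "- int q"]
      by (simp add: orbit_sum_def e add_ac)
  qed (unfold a1_lam_1 a2_lam_1 orbit_sum_def pair_sum_def,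
       auto simp: T_initial T_2 algebra_simps power2_eq_square)
qed

lemma orbit_sum_raise_q:
  "orbit_sum 0 (Suc q) = 3 * Zbar * orbit_sum 0 q + scalar (a1 1 q) * 3 * orbit_sum 1 (q - 1)"
proof -
  consider "q = 0" | "q = 1" | "q \<ge> 2" by linarith
  then show ?thesis
  proof cases
    case 3
    have e: "- int q - 1 = - 1 - int q" by simp
    show ?thesis unfolding a1_lam_1 orbit_sum_def pair_sum_def
      using 3 T_recurrence[of "- int q"]
      by (simp add: e T_initial of_nat_diff algebra_simps)
  qed (unfold a1_lam_1 orbit_sum_def pair_sum_def,
       auto simp: T_initial T_2 algebra_simps power2_eq_square)
qed

section \<open>Identification of \<open>P\<close> and the closed form\<close>

text \<open>Relative to the step p + q to p + q + 1, the scaling puts a factor 3 on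
  \<open>Zvar\<close>, \<open>Zbar\<close> and \<open>a1\<close>, and 9 on \<open>a2\<close>, whose
  term has index sum p + q - 1.\<close>

lemma P_eq_orbit_sum: "3 ^ (p + q) * P (- 1 / 2) p q = orbit_sum p q"
proof (induction "- 1 / 2 :: real" p q rule: P.induct)
  case 1
  then show ?case by (simp add: P.simps(1) orbit_sum_def)
next
  case (2 p q)
  have a: "scalar (a1 1 p) * 3 ^ Suc (p + q) * P (- 1 / 2) (p - 1) (q + 1)
      = scalar (a1 1 p) * 3 * orbit_sum (p - 1) (q + 1)"
    \<comment> \<open>At \<open>p = 0\<close>, where \<open>p - 1\<close> truncates, the coefficient
      vanishes.\<close>
    by (cases p) (use 2(2) in \<open>auto simp: mult.assoc\<close>)
  have b: "scalar (a2 1 p q) * 3 ^ Suc (p + q) * P (- 1 / 2) p (q - 1)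
      = scalar (a2 1 p q) * 9 * orbit_sum p (q - 1)"
    by (cases q) (use 2(3) in \<open>auto simp: mult.assoc\<close>)
  have "3 ^ (Suc p + q) * P (- 1 / 2) (Suc p) q
      = 3 * Zvar * (3 ^ (p + q) * P (- 1 / 2) p q)
        + scalar (a1 1 p) * 3 ^ Suc (p + q) * P (- 1 / 2) (p - 1) (q + 1)
        + scalar (a2 1 p q) * 3 ^ Suc (p + q) * P (- 1 / 2) p (q - 1)"
    using P_raise_p[of "- 1 / 2" p q] by (simp add: lam_def algebra_simps)
  then show ?case unfolding a b 2(1) orbit_sum_raise_p .
next
  case (3 q)
  have a: "scalar (a1 1 q) * 3 ^ Suc q * P (- 1 / 2) 1 (q - 1)
      = scalar (a1 1 q) * 3 * orbit_sum 1 (q - 1)"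
    by (cases q) (use 3(2) in \<open>auto simp: mult.assoc\<close>)
  have "3 ^ (0 + Suc q) * P (- 1 / 2) 0 (Suc q)
      = 3 * Zbar * (3 ^ (0 + q) * P (- 1 / 2) 0 q)
        + scalar (a1 1 q) * 3 ^ Suc q * P (- 1 / 2) 1 (q - 1)"
    by (simp add: P.simps(3) lam_def algebra_simps)
  then show ?case unfolding a 3(1) orbit_sum_raise_q .
qed

lemma P_eq_scaled_orbit_sum:
  "P (- 1 / 2) p q = scalar (3 powi (- int (p + q))) * orbit_sum p q"
proof -
  have "scalar (3 powi (- int (p + q)) * 3 ^ (p + q)) = 1"
    by (simp only: power_int_minus power_int_of_nat) simp
  then have "scalar (3 powi (- int (p + q))) * 3 ^ (p + q) = 1"
    by (simp only: scalar_simps scalar_power scalar_numeral)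
  then show ?thesis
    unfolding P_eq_orbit_sum[symmetric] by (simp only: mult.assoc[symmetric]) simp
qed

theorem mainTheorem5:
  shows "(\<forall>p::nat. p \<ge> 1 \<longrightarrow>
            P (- 1 / 2) p 0 = Q (int p) \<and> P (- 1 / 2) 0 p = Q (- int p)) \<and>
         (\<forall>p q::nat. p \<ge> 1 \<and> q \<ge> 1 \<longrightarrow>
            P (- 1 / 2) p q =
              Q (int p) * Q (- int q)
              - scalar (3 powi (- 2 * int (min p q))) * Q (int p - int q))"
proof (intro conjI allI impI)
  fix p :: nat
  assume "p \<ge> 1"
  then show "P (- 1 / 2) p 0 = Q (int p)" "P (- 1 / 2) 0 p = Q (- int p)"
    unfolding P_eq_scaled_orbit_sum by (simp_all add: orbit_sum_def Q_def)
next
  fix p q :: nat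
  assume pq: "p \<ge> 1 \<and> q \<ge> 1"
  \<comment> \<open>Hence both terms of the closed form carry the same factor 3^-(p+q), and what
    remains is \<open>pair_sum\<close> at \<open>int p\<close> and \<open>- int q\<close>.\<close>
  have "- 2 * int (min p q) + - \<bar>int p - int q\<bar> = - int (p + q)"
    by (simp add: min_def)
  then have "(3 :: real) powi (- 2 * int (min p q)) * 3 powi (- \<bar>int p - int q\<bar>)
      = 3 powi (- int (p + q))"
    by (metis power_int_add zero_neq_numeral)
  then have b: "scalar (3 powi (- 2 * int (min p q))) * Q (int p - int q)
      = scalar (3 powi (- int (p + q))) * T (int p - int q)"
    by (simp only: Q_def mult.assoc[symmetric] scalar_simps(6)[symmetric])
  have "(3 :: real) powi (- \<bar>int p\<bar>) * 3 powi (- \<bar>- int q\<bar>) = 3 powi (- int (p + q))"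
    by (simp flip: power_int_add)
  then have a: "Q (int p) * Q (- int q)
      = scalar (3 powi (- int (p + q))) * (T (int p) * T (- int q))"
    unfolding Q_def by (metis (no_types, lifting) mult.assoc mult.left_commute scalar_simps(6))
  show "P (- 1 / 2) p q = Q (int p) * Q (- int q)
      - scalar (3 powi (- 2 * int (min p q))) * Q (int p - int q)"
    unfolding a b P_eq_scaled_orbit_sum using pq
    by (simp add: orbit_sum_def pair_sum_def right_diff_distrib)
qed

end
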